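(* The usual multiplication of complex numbers is distributive over the tropical addition: $a(b\smile c)=ab\smile ac$ for any complex numbers $a$, $b$ and $c$.
   Context: Tropical addition on $\mathbb{C}$ is the multivalued operation $\smile$ defined by: if $|a|>|b|$, then $a\smile b=\{a\}$; if $|a|<|b|$, then $a\smile b=\{b\}$; if $|a|=|b|$ and $a+b\ne0$, then $a\smile b$ is the set of all complex numbers on the (closed) shortest arc connecting $a$ with $b$ on the circle $\{z\mid|z|=|a|\}$, i.e. if $a=re^{\alpha i}$, $b=re^{\beta i}$ with $|\beta-\alpha|<\pi$, then $a\smile b=\{re^{\varphi i}\mid|\alpha-\varphi|+|\varphi-\beta|=|\alpha-\beta|\}$; if $a+b=0$, then $a\smile b$ is the closed disk $\{c\in\mathbb{C}\mid|c|\le|a|\}$. For $a\in\mathbb{C}$ and $B\subset\mathbb{C}$, $aB=\{ab\mid b\in B\}$. *)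

theory Defs
  imports Complex_Main
begin

definition short_arc :: "complex \<Rightarrow> complex \<Rightarrow> complex set" where
  "short_arc a b = {of_real r * cis \<phi> | r \<phi>. r > 0 \<and> (\<exists>\<alpha> \<beta>.
     a = of_real r * cis \<alpha> \<and> b = of_real r * cis \<beta> \<and> \<bar>\<beta> - \<alpha>\<bar> < pi \<and>
     \<bar>\<alpha> - \<phi>\<bar> + \<bar>\<phi> - \<beta>\<bar> = \<bar>\<alpha> - \<beta>\<bar>)}"

text \<open>The existentially quantified arguments are harmless: every admissible choice of
  \<open>\<alpha>\<close> and \<open>\<beta>\<close> describes the same arc.\<close>

lemma short_arc_polar:
  assumes r: "r > 0" and d: "\<bar>\<beta> - \<alpha>\<bar> < pi"
  shows "short_arc (of_real r * cis \<alpha>) (of_real r * cis \<beta>) =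
    {of_real r * cis \<phi> | \<phi>. \<bar>\<alpha> - \<phi>\<bar> + \<bar>\<phi> - \<beta>\<bar> = \<bar>\<alpha> - \<beta>\<bar>}" (is "?L = ?R")
proof
  show "?R \<subseteq> ?L" unfolding short_arc_def using r d by blast
  show "?L \<subseteq> ?R"
  proof
    fix z assume "z \<in> ?L"
    then obtain s \<phi> \<alpha>' \<beta>' where s: "s > 0" and z: "z = of_real s * cis \<phi>"
      and a: "of_real r * cis \<alpha> = of_real s * cis \<alpha>'"
      and b: "of_real r * cis \<beta> = of_real s * cis \<beta>'"
      and d': "\<bar>\<beta>' - \<alpha>'\<bar> < pi"
      and e: "\<bar>\<alpha>' - \<phi>\<bar> + \<bar>\<phi> - \<beta>'\<bar> = \<bar>\<alpha>' - \<beta>'\<bar>"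
      unfolding short_arc_def by blast
    have rs: "r = s" using arg_cong[OF a, of cmod] r s by (simp add: norm_mult)
    have "cis \<alpha> = cis \<alpha>'" "cis \<beta> = cis \<beta>'" using a b rs s by simp_all
    then have "sin \<alpha> = sin \<alpha>' \<and> cos \<alpha> = cos \<alpha>'" "sin \<beta> = sin \<beta>' \<and> cos \<beta> = cos \<beta>'"
      by (simp_all add: complex_eq_iff)
    then obtain k m :: int where k: "\<alpha> = \<alpha>' + 2 * pi * of_int k" and m: "\<beta> = \<beta>' + 2 * pi * of_int m"
      unfolding sin_cos_eq_iff by (auto simp: algebra_simps)
    have "\<bar>2 * pi * of_int (m - k)\<bar> < 2 * pi * 1"
      using d d' unfolding k m by (simp add: algebra_simps abs_if split: if_splits)
    then have "\<bar>real_of_int (m - k)\<bar> < 1"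
      unfolding abs_mult by simp
    then have mk: "m = k" by linarith
    have "cis (\<phi> + 2 * pi * of_int k) = cis \<phi>"
      by (simp add: cis_mult[symmetric] cis_multiple_2pi)
    then have "z = of_real r * cis (\<phi> + 2 * pi * of_int k)" by (simp add: z rs)
    moreover have "\<bar>\<alpha> - (\<phi> + 2 * pi * of_int k)\<bar> + \<bar>\<phi> + 2 * pi * of_int k - \<beta>\<bar> = \<bar>\<alpha> - \<beta>\<bar>"
      using e unfolding k m mk by simp
    ultimately show "z \<in> ?R" by blast
  qed
qed

definition trop_add :: "complex \<Rightarrow> complex \<Rightarrow> complex set" (infixl "\<smile>" 65) where
  "a \<smile> b =
    (if cmod a > cmod b then {a}
     else if cmod a < cmod b then {b}
     else if a + b \<noteq> 0 then short_arc a b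
     else {c. cmod c \<le> cmod a})"

end

theory Submission
  imports Defs
begin

text \<open>Multiplication by a nonzero \<open>a\<close> is a rotation composed with a dilation by
  \<open>cmod a\<close>. It preserves the comparison of moduli and the vanishing of
  \<open>b + c\<close>, so both sides fall into the same case of \<open>trop_add\<close>; it carries
  short arcs to short arcs (\<open>mult_short_arc\<close>) and centred disks to centred disks
  (\<open>mult_disk\<close>). For \<open>a = 0\<close> both sides are {0}, provided that tropical
  sums are never empty (\<open>trop_add_nonempty\<close>).\<close>

lemma mult_short_arc_subset:
  assumes "a \<noteq> 0"
  shows "(*) a ` short_arc b c \<subseteq> short_arc (a * b) (a * c)"
proof
  fix z assume "z \<in> (*) a ` short_arc b c"
  then obtain r \<phi> \<alpha> \<beta> where r: "r > 0" and z: "z = a * (of_real r * cis \<phi>)"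
    and b: "b = of_real r * cis \<alpha>" and c: "c = of_real r * cis \<beta>"
    and d: "\<bar>\<beta> - \<alpha>\<bar> < pi" and e: "\<bar>\<alpha> - \<phi>\<bar> + \<bar>\<phi> - \<beta>\<bar> = \<bar>\<alpha> - \<beta>\<bar>"
    unfolding short_arc_def by blast
  define s \<gamma> where "s = cmod a" and "\<gamma> = Arg a"
  \<comment> \<open>All three angles shift by the same \<gamma>, so the differences that define the
    arc do not change. The shifted angles need no reduction modulo 2 pi, since
    \<open>short_arc\<close> admits arbitrary real angles.\<close>
  have rotate: "a * (of_real r * cis \<theta>) = of_real (s * r) * cis (\<gamma> + \<theta>)" for \<theta>
    using rcis_cmod_Arg[of a] by (simp add: s_def \<gamma>_def rcis_def flip: cis_mult)
  have "s * r > 0" "\<bar>(\<gamma> + \<beta>) - (\<gamma> + \<alpha>)\<bar> < pi"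
    "\<bar>(\<gamma> + \<alpha>) - (\<gamma> + \<phi>)\<bar> + \<bar>(\<gamma> + \<phi>) - (\<gamma> + \<beta>)\<bar> = \<bar>(\<gamma> + \<alpha>) - (\<gamma> + \<beta>)\<bar>"
    using assms r d e by (simp_all add: s_def)
  then show "z \<in> short_arc (a * b) (a * c)"
    unfolding short_arc_def z b c rotate by blast
qed

text \<open>Scaling by \<open>a\<close> is undone by scaling by \<open>inverse a\<close>, so an
  inclusion proved for every nonzero factor upgrades itself to an equality.\<close>

lemma image_mult_eqI:
  fixes a :: "'a::field"
  assumes "a \<noteq> 0" and "(*) a ` B \<subseteq> C" and "(*) (inverse a) ` C \<subseteq> B"
  shows "(*) a ` B = C"
proof
  show "C \<subseteq> (*) a ` B"
  proof
    fix z assume "z \<in> C"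
    then have "inverse a * z \<in> B" using assms(3) by blast
    moreover have "z = a * (inverse a * z)" using assms(1) by simp
    ultimately show "z \<in> (*) a ` B" by (rule rev_image_eqI)
  qed
qed (rule assms(2))

lemma mult_short_arc:
  assumes "a \<noteq> 0"
  shows "(*) a ` short_arc b c = short_arc (a * b) (a * c)"
proof (rule image_mult_eqI[OF assms mult_short_arc_subset[OF assms]])
  show "(*) (inverse a) ` short_arc (a * b) (a * c) \<subseteq> short_arc b c"
    using mult_short_arc_subset[of "inverse a" "a * b" "a * c"] assms
    by (simp flip: mult.assoc)
qed

lemma mult_disk:
  fixes a :: complex
  assumes "a \<noteq> 0"
  shows "(*) a ` {z. cmod z \<le> r} = {z. cmod z \<le> cmod a * r}"
  using assms
  by (intro image_mult_eqI) (auto simp: norm_mult norm_divide field_simps)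

text \<open>Supplies a point of the arc for \<open>trop_add_nonempty\<close>. The content is that
  suitable angles exist whenever the moduli agree and the points are not antipodal.\<close>

lemma left_mem_short_arc:
  assumes "cmod a = cmod b" and "a + b \<noteq> 0"
  shows "a \<in> short_arc a b"
proof -
  have nz: "a \<noteq> 0" "b \<noteq> 0" using assms by auto
  \<comment> \<open>The second angle is \<alpha> + \<theta> rather than \<open>Arg b\<close>,
    because \<open>Arg a\<close> and \<open>Arg b\<close> may differ by pi or more when the short
    arc crosses the negative real axis.\<close>
  define \<alpha> \<theta> where "\<alpha> = Arg a" and "\<theta> = Arg (b / a)"
  have a: "a = of_real (cmod a) * cis \<alpha>"
    using rcis_cmod_Arg[of a] by (simp add: \<alpha>_def rcis_def)
  have q: "b / a = cis \<theta>"
    using rcis_cmod_Arg[of "b / a"] assms(1) nz by (simp add: \<theta>_def rcis_def norm_divide)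
  have "b = a * cis \<theta>" using nz by (simp flip: q)
  then have b: "b = of_real (cmod a) * cis (\<alpha> + \<theta>)"
    using a by (metis cis_mult mult.assoc)
  \<comment> \<open>An angle of pi would mean \<open>b / a = -1\<close>, that is,
    \<open>a + b = 0\<close>.\<close>
  have "\<theta> \<noteq> pi" using q assms(2) nz by (auto simp: field_simps)
  moreover have "- pi < \<theta>" "\<theta> \<le> pi" using Arg_bounded[of "b / a"] by (auto simp: \<theta>_def)
  ultimately have "\<bar>(\<alpha> + \<theta>) - \<alpha>\<bar> < pi" by simp
  moreover have "\<bar>\<alpha> - \<alpha>\<bar> + \<bar>\<alpha> - (\<alpha> + \<theta>)\<bar> = \<bar>\<alpha> - (\<alpha> + \<theta>)\<bar>" by simp
  moreover have "cmod a > 0" using nz by simp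
  ultimately show ?thesis unfolding short_arc_def using a b by blast
qed

lemma trop_add_nonempty: "a \<smile> b \<noteq> {}"
proof -
  have "0 \<in> {c. cmod c \<le> cmod a}" by simp
  then show ?thesis
    unfolding trop_add_def using left_mem_short_arc[of a b] by (auto simp: not_less)
qed

theorem theorem6:
  fixes a b c :: complex
  shows "(*) a ` (b \<smile> c) = (a * b) \<smile> (a * c)"
proof (cases "a = 0")
  case True
  have "(*) 0 ` (b \<smile> c) = {0}"
    using trop_add_nonempty[of b c] by auto
  \<comment> \<open>Here 0 \<smile> 0 is the closed disk of radius 0.\<close>
  then show ?thesis using True by (simp add: trop_add_def)
next
  case False
  then have "a * b + a * c = 0 \<longleftrightarrow> b + c = 0"
    by (simp flip: distrib_left)
  then show ?thesis
    using False by (simp add: trop_add_def norm_mult mult_short_arc mult_disk)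
qed

end
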